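(* For all positive integers $m,n$, the rooks graph $K_m\,\Box\,K_n$ can be $2$-colored with defect $\lceil m/2\rceil+\lceil n/2\rceil-2$.
   Context: Graphs are finite and simple. For a graph $G$ and a positive integer $k$, a (fractional) $k$-coloring of $G$ is an assignment to every vertex $v$ of real numbers $f_1(v),\dots,f_k(v)\ge 0$ with $\sum_{j=1}^k f_j(v)=1$ ($f_j(v)$ is the usage of color $j$ at $v$). The defect of $v$ is $\mathrm{df}(v)=\sum_{w\in N(v)}\sum_{j=1}^k\min(f_j(v),f_j(w))$, where $N(v)$ is the set of neighbors of $v$. The defect of the coloring is $\max_v \mathrm{df}(v)$. $G\,\Box\,H$ denotes the Cartesian product: its vertex set is $V(G)\times V(H)$, and $(u_1,u_2)$, $(v_1,v_2)$ are adjacent if $u_1v_1\in E(G)$ and $u_2=v_2$, or $u_1=v_1$ and $u_2v_2\in E(H)$. The rooks graph is $K_m\,\Box\,K_n$, where $K_s$ is the complete graph on $s$ vertices. *)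

theory Defs
  imports Complex_Main "Graph_Theory.Graph_Theory"
begin

text \<open>
  A finite simple graph is a \<^locale>\<open>pair_graph\<close>: each edge \<open>uv\<close> is represented by the two
  arcs \<open>(u, v)\<close> and \<open>(v, u)\<close>.
\<close>

definition neighbors :: "'a pair_pre_digraph \<Rightarrow> 'a \<Rightarrow> 'a set" where
  "neighbors G v = {w. (v, w) \<in> parcs G}"

text \<open>\<open>f v j\<close> is the usage of color \<open>j\<close> at \<open>v\<close>; the colors are \<open>1, \<dots>, k\<close>.\<close>

definition fractional_coloring ::
    "'a pair_pre_digraph \<Rightarrow> nat \<Rightarrow> ('a \<Rightarrow> nat \<Rightarrow> real) \<Rightarrow> bool" where
  "fractional_coloring G k f \<longleftrightarrow>
     (\<forall>v \<in> pverts G. (\<forall>j \<in> {1..k}. 0 \<le> f v j) \<and> (\<Sum>j = 1..k. f v j) = 1)"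

definition vertex_defect ::
    "'a pair_pre_digraph \<Rightarrow> nat \<Rightarrow> ('a \<Rightarrow> nat \<Rightarrow> real) \<Rightarrow> 'a \<Rightarrow> real" where
  "vertex_defect G k f v = (\<Sum>w \<in> neighbors G v. \<Sum>j = 1..k. min (f v j) (f w j))"

definition defect :: "'a pair_pre_digraph \<Rightarrow> nat \<Rightarrow> ('a \<Rightarrow> nat \<Rightarrow> real) \<Rightarrow> real" where
  "defect G k f = Max (vertex_defect G k f ` pverts G)"

definition cartesian_product ::
    "'a pair_pre_digraph \<Rightarrow> 'b pair_pre_digraph \<Rightarrow> ('a \<times> 'b) pair_pre_digraph"
    (infixl \<open>\<box>\<close> 70) where
  "G \<box> H = \<lparr>
     pverts = pverts G \<times> pverts H,
     parcs = {((u1, u2), (v1, v2)).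
       {(u1, u2), (v1, v2)} \<subseteq> pverts G \<times> pverts H \<and>
       ((u1, v1) \<in> parcs G \<and> u2 = v2 \<or> u1 = v1 \<and> (u2, v2) \<in> parcs H)} \<rparr>"

lemma pair_graph_cartesian_product:
  assumes "pair_graph G" "pair_graph H"
  shows "pair_graph (G \<box> H)"
proof -
  interpret G: pair_graph G by fact
  interpret H: pair_graph H by fact
  have sub: "parcs (G \<box> H) \<subseteq> (pverts G \<times> pverts H) \<times> (pverts G \<times> pverts H)"
    by (auto simp: cartesian_product_def)
  have symG: "(v, u) \<in> parcs G" if "(u, v) \<in> parcs G" for u v
    using G.pair_sym_arcs that by (auto simp: symmetric_def sym_def)
  have symH: "(v, u) \<in> parcs H" if "(u, v) \<in> parcs H" for u v
    using H.pair_sym_arcs that by (auto simp: symmetric_def sym_def)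
  show ?thesis
  proof
    show "finite (pverts (G \<box> H))"
      by (simp add: cartesian_product_def)
    show "finite (parcs (G \<box> H))"
      using sub by (rule finite_subset) simp
    show "symmetric (with_proj (G \<box> H))"
      by (auto simp: symmetric_def sym_def cartesian_product_def intro: symG symH)
  qed (auto simp: cartesian_product_def dest: G.pair_no_loops H.pair_no_loops)
qed

lemma complete_digraph_exists:
  "complete_digraph n (with_proj \<lparr>pverts = {..<n}, parcs = {(u, v). u < n \<and> v < n \<and> u \<noteq> v}\<rparr>)"
  by (auto simp: complete_digraph_pair_def)

end

theory Submission
  imports Defs
begin

text \<open>
  A coloring that uses a single color at each vertex suffices. Split the vertices of \<open>K\<^sub>m\<close> into
  two classes that are as equal as possible, do the same for \<open>K\<^sub>n\<close>, and give \<open>(u, v)\<close> the first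
  color iff \<open>u\<close> and \<open>v\<close> both lie in the larger class or both in the smaller one. Along a row
  or a column one coordinate stays fixed, so two vertices there share a color exactly when their
  moving coordinates lie in the same class. The defect of \<open>(u, v)\<close> is therefore the number of other
  members of the class of \<open>u\<close> plus the number of other members of the class of \<open>v\<close>. The larger
  classes have \<open>\<lceil>m/2\<rceil>\<close> and \<open>\<lceil>n/2\<rceil>\<close> elements, and both are nonempty, so the maximum
  \<open>\<lceil>m/2\<rceil> + \<lceil>n/2\<rceil> - 2\<close> is attained where they meet.
\<close>

definition class_of :: "'a set \<Rightarrow> 'a set \<Rightarrow> 'a \<Rightarrow> 'a set" where
  "class_of V A x = {w \<in> V. w \<in> A \<longleftrightarrow> x \<in> A}"

definition checkerboard :: "'a set \<Rightarrow> 'b set \<Rightarrow> 'a \<times> 'b \<Rightarrow> nat \<Rightarrow> real" where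
  "checkerboard A B p j = of_bool ((j = 1) = (fst p \<in> A \<longleftrightarrow> snd p \<in> B))"

lemma fractional_coloring_checkerboard: "fractional_coloring G 2 (checkerboard A B)"
  by (simp add: fractional_coloring_def checkerboard_def numeral_2_eq_2)

text \<open>For one-color-per-vertex colorings the defect counts the neighbors of equal color.\<close>

lemma sum_min_checkerboard:
  "(\<Sum>j = 1..2. min (checkerboard A B p j) (checkerboard A B q j)) =
     of_bool ((fst p \<in> A \<longleftrightarrow> snd p \<in> B) = (fst q \<in> A \<longleftrightarrow> snd q \<in> B))"
  by (auto simp: checkerboard_def numeral_2_eq_2)

lemma neighbors_complete:
  assumes "complete_digraph n (with_proj G)" "u \<in> pverts G"
  shows "neighbors G u = pverts G - {u}"
  using assms by (auto simp: neighbors_def complete_digraph_pair_def)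

lemma neighbors_cartesian_product:
  assumes "u \<in> pverts G" "v \<in> pverts H" "neighbors G u \<subseteq> pverts G" "neighbors H v \<subseteq> pverts H"
  shows "neighbors (G \<box> H) (u, v) = neighbors G u \<times> {v} \<union> {u} \<times> neighbors H v"
  using assms by (auto simp: neighbors_def cartesian_product_def)

text \<open>
  Moving along one factor keeps the other coordinate, so color equality reduces to lying in the
  same class of the moving coordinate. The \<open>2\<close> accounts for \<open>u\<close> and \<open>v\<close>, each a member of its
  own class but not its own neighbor.
\<close>

lemma vertex_defect_checkerboard:
  assumes G: "complete_digraph m (with_proj G)" and H: "complete_digraph n (with_proj H)"
    and fin: "finite (pverts G)" "finite (pverts H)"
    and u: "u \<in> pverts G" and v: "v \<in> pverts H"
  shows "vertex_defect (G \<box> H) 2 (checkerboard A B) (u, v) =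
           real (card (class_of (pverts G) A u)) + real (card (class_of (pverts H) B v)) - 2"
proof -
  let ?C = "class_of (pverts G) A u" and ?D = "class_of (pverts H) B v"
  let ?N = "neighbors (G \<box> H) (u, v)"
  let ?same = "\<lambda>q. (u \<in> A \<longleftrightarrow> v \<in> B) = (fst q \<in> A \<longleftrightarrow> snd q \<in> B)"
  have N: "?N = (pverts G - {u}) \<times> {v} \<union> {u} \<times> (pverts H - {v})"
    using neighbors_cartesian_product[of u G v H] neighbors_complete[OF G u]
      neighbors_complete[OF H v] u v by auto
  have finN: "finite ?N"
    using fin by (simp add: N)
  have same: "{q \<in> ?N. ?same q} = (?C - {u}) \<times> {v} \<union> {u} \<times> (?D - {v})"
    by (auto simp: N class_of_def)
  have C: "u \<in> ?C" "finite ?C" and D: "v \<in> ?D" "finite ?D"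
    using u v fin by (simp_all add: class_of_def)
  have "vertex_defect (G \<box> H) 2 (checkerboard A B) (u, v) = (\<Sum>q\<in>?N. of_bool (?same q))"
    unfolding vertex_defect_def sum_min_checkerboard by simp
  also have "\<dots> = real (card {q \<in> ?N. ?same q})"
    using finN by (simp add: of_bool_def sum.If_cases Int_def)
  also have "card {q \<in> ?N. ?same q} = card (?C - {u}) + card (?D - {v})"
    unfolding same using C D by (subst card_Un_disjoint) (auto simp: card_cartesian_product)
  also have "real \<dots> = real (card ?C) + real (card ?D) - 2"
    using C D card_gt_0_iff[of ?C] card_gt_0_iff[of ?D] by (auto simp: of_nat_diff)
  finally show ?thesis .
qed

lemma ex_balanced_subset:
  assumes "finite V"
  obtains A where "A \<subseteq> V" "real (card A) = of_int \<lceil>real (card V) / 2\<rceil>"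
    "card (V - A) \<le> card A"
proof -
  have "(card V + 1) div 2 \<le> card V"
    by linarith
  then obtain A where A: "A \<subseteq> V" "card A = (card V + 1) div 2"
    by (meson obtain_subset_with_card_n)
  have "\<lceil>real (card V) / 2\<rceil> = int ((card V + 1) div 2)"
    by linarith
  moreover have "card (V - A) \<le> card A"
    using A assms by (simp add: card_Diff_subset finite_subset)
  ultimately show thesis
    using A that by simp
qed

lemma class_of_member: "A \<subseteq> V \<Longrightarrow> x \<in> A \<Longrightarrow> class_of V A x = A"
  by (auto simp: class_of_def)

lemma class_of_non_member: "x \<notin> A \<Longrightarrow> class_of V A x = V - A"
  by (auto simp: class_of_def)

lemma card_class_of_le:
  assumes "A \<subseteq> V" "card (V - A) \<le> card A"
  shows "card (class_of V A x) \<le> card A"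
  using assms by (cases "x \<in> A") (simp_all add: class_of_member class_of_non_member)

theorem lemma8:
  fixes m n :: nat
    and G :: "'a pair_pre_digraph" and H :: "'b pair_pre_digraph"
  assumes "0 < m" and "0 < n"
    and "complete_digraph m (with_proj G)" and "complete_digraph n (with_proj H)"
  shows "\<exists>f. fractional_coloring (G \<box> H) 2 f \<and>
           defect (G \<box> H) 2 f = of_int (\<lceil>real m / 2\<rceil> + \<lceil>real n / 2\<rceil> - 2)"
proof -
  let ?V = "pverts G" and ?W = "pverts H"
  have card: "card ?V = m" "card ?W = n"
    using assms(3,4) by (simp_all add: complete_digraph_def)
  then have fin: "finite ?V" "finite ?W"
    using assms(1,2) card_ge_0_finite by auto
  obtain A where A: "A \<subseteq> ?V" "real (card A) = of_int \<lceil>real m / 2\<rceil>" "card (?V - A) \<le> card A"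
    using ex_balanced_subset[OF fin(1)] card by metis
  obtain B where B: "B \<subseteq> ?W" "real (card B) = of_int \<lceil>real n / 2\<rceil>" "card (?W - B) \<le> card B"
    using ex_balanced_subset[OF fin(2)] card by metis
  have "0 < real (card A)" "0 < real (card B)"
    unfolding A(2) B(2) using assms(1,2) by simp_all
  then obtain a b where ab: "a \<in> A" "b \<in> B"
    by fastforce
  let ?df = "vertex_defect (G \<box> H) 2 (checkerboard A B)"
  let ?d = "real (card A) + real (card B) - 2"
  note df = vertex_defect_checkerboard[OF assms(3,4) fin]
  have "defect (G \<box> H) 2 (checkerboard A B) = ?d"
    unfolding defect_def
  proof (rule Max_eqI)
    show "finite (?df ` pverts (G \<box> H))"
      using fin by (simp add: cartesian_product_def)
    have "?df (a, b) = ?d"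
      using df[of a b A B] A(1) B(1) ab by (auto simp: class_of_member)
    moreover have "(a, b) \<in> pverts (G \<box> H)"
      using A(1) B(1) ab by (auto simp: cartesian_product_def)
    ultimately show "?d \<in> ?df ` pverts (G \<box> H)"
      by (metis imageI)
  next
    fix y assume "y \<in> ?df ` pverts (G \<box> H)"
    then obtain u v where "u \<in> ?V" "v \<in> ?W" "y = ?df (u, v)"
      by (auto simp: cartesian_product_def)
    then show "y \<le> ?d"
      using card_class_of_le[OF A(1,3), of u] card_class_of_le[OF B(1,3), of v] df[of u v A B] by simp
  qed
  then show ?thesis
    using fractional_coloring_checkerboard[of "G \<box> H" A B] A(2) B(2)
    by (intro exI[of _ "checkerboard A B"]) simp
qed

end
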